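(* Let $(M,g)$ be an $n$-dimensional ($n>3$) weakly $Z$ symmetric manifold $(WZS)_n$ with non singular $Z$ tensor. Then $\omega_k=A_k-B_k$ is a closed 1-form if and only if $$R_{im}R_{jkl}{}^m+R_{jm}R_{kil}{}^m+R_{km}R_{ijl}{}^m=0.$$
   Context: $(M,g)$ is an $n$-dimensional Riemannian manifold with Levi-Civita connection $\nabla$; index notation with summation over repeated indices; $R_{jkl}{}^m$ is the Riemann tensor, $R_{kl}=-R_{mkl}{}^m$ the Ricci tensor, $R=g^{ij}R_{ij}$ the scalar curvature. Generalized $Z$ tensor: $Z_{kl}=R_{kl}+\phi\,g_{kl}$, where $\phi$ is an arbitrary scalar function. The manifold is weakly $Z$ symmetric, $(WZS)_n$, if for some $\phi$ there are covectors $A_k,B_k,D_k$ with $$\nabla_kZ_{jl}=A_kZ_{jl}+B_jZ_{kl}+D_lZ_{kj}.$$ The $Z$ tensor is non singular if there is a $(2,0)$ tensor $Z^{-1}$ with $(Z^{-1})^{kh}Z_{kl}=\delta^h{}_l$. A 1-form $\omega_k$ is closed if $\nabla_i\omega_j-\nabla_j\omega_i=0$. *)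

theory Defs
  imports "HOL-Analysis.Analysis"
begin

definition pd :: "'n \<Rightarrow> (real^'n \<Rightarrow> real) \<Rightarrow> real^'n \<Rightarrow> real" where
  "pd i f x = frechet_derivative f (at x) (axis i 1)"

text \<open>Meant for open sets only, where \<open>Ck_on k\<close> is the usual class of \<open>k\<close> times
  continuously differentiable functions.\<close>

primrec Ck_on :: "nat \<Rightarrow> (real^'n) set \<Rightarrow> (real^'n \<Rightarrow> real) \<Rightarrow> bool" where
  "Ck_on 0 S f \<longleftrightarrow> continuous_on S f"
| "Ck_on (Suc k) S f \<longleftrightarrow> (\<forall>x\<in>S. f differentiable (at x)) \<and> (\<forall>i. Ck_on k S (pd i f))"

definition smooth_on :: "(real^'n) set \<Rightarrow> (real^'n \<Rightarrow> real) \<Rightarrow> bool" where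
  "smooth_on S f \<longleftrightarrow> (\<forall>k. Ck_on k S f)"

text \<open>A chart is a pair of its domain and its coordinate map. The value of the map
  outside the domain is irrelevant.\<close>

type_synonym ('m, 'n) chart = "'m set \<times> ('m \<Rightarrow> real^'n)"

definition coords :: "('m, 'n::finite) chart \<Rightarrow> (real^'n) set" where
  "coords c = snd c ` fst c"

definition point :: "('m, 'n::finite) chart \<Rightarrow> real^'n \<Rightarrow> 'm" where
  "point c = inv_into (fst c) (snd c)"

definition overlap :: "('m, 'n::finite) chart \<Rightarrow> ('m, 'n) chart \<Rightarrow> (real^'n) set" where
  "overlap c d = snd c ` (fst c \<inter> fst d)"

definition transition :: "('m, 'n::finite) chart \<Rightarrow> ('m, 'n) chart \<Rightarrow> real^'n \<Rightarrow> real^'n" where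
  "transition c d x = snd d (point c x)"

definition jac :: "('m, 'n::finite) chart \<Rightarrow> ('m, 'n) chart \<Rightarrow> real^'n \<Rightarrow> 'n \<Rightarrow> 'n \<Rightarrow> real" where
  "jac c d x a i = pd i (\<lambda>y. transition c d y $ a) x"

definition is_chart :: "'m topology \<Rightarrow> ('m, 'n::finite) chart \<Rightarrow> bool" where
  "is_chart X c \<longleftrightarrow> openin X (fst c) \<and> open (coords c) \<and>
     homeomorphic_map (subtopology X (fst c)) (top_of_set (coords c)) (snd c)"

text \<open>The smooth structure is the one generated by the (not necessarily maximal) atlas \<open>C\<close>.\<close>

definition smooth_manifold :: "'m topology \<Rightarrow> ('m, 'n::finite) chart set \<Rightarrow> bool" where
  "smooth_manifold X C \<longleftrightarrow> Hausdorff_space X \<and> second_countable X \<and>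
     (\<forall>c\<in>C. is_chart X c) \<and> (\<Union>c\<in>C. fst c) = topspace X \<and>
     (\<forall>c\<in>C. \<forall>d\<in>C. \<forall>a. smooth_on (overlap c d) (\<lambda>x. transition c d x $ a))"

text \<open>A tensor field is the family of its component functions: \<open>T c x i j\<close> is the component
  with indices \<open>i j\<close> in the chart \<open>c\<close> at the point with coordinates \<open>x\<close>. Families of
  components in different charts are related by the tensor transformation law.\<close>

definition scalar_field :: "('m, 'n::finite) chart set \<Rightarrow> ('m \<Rightarrow> real) \<Rightarrow> bool" where
  "scalar_field C f \<longleftrightarrow> (\<forall>c\<in>C. smooth_on (coords c) (f \<circ> point c))"

definition covector_field ::
    "('m, 'n::finite) chart set \<Rightarrow> (('m, 'n) chart \<Rightarrow> real^'n \<Rightarrow> 'n \<Rightarrow> real) \<Rightarrow> bool" where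
  "covector_field C u \<longleftrightarrow>
     (\<forall>c\<in>C. \<forall>i. smooth_on (coords c) (\<lambda>x. u c x i)) \<and>
     (\<forall>c\<in>C. \<forall>d\<in>C. \<forall>x\<in>overlap c d. \<forall>i.
        u c x i = (\<Sum>a\<in>UNIV. jac c d x a i * u d (transition c d x) a))"

definition covariant_2_tensor_field ::
    "('m, 'n::finite) chart set \<Rightarrow> (('m, 'n) chart \<Rightarrow> real^'n \<Rightarrow> 'n \<Rightarrow> 'n \<Rightarrow> real) \<Rightarrow> bool" where
  "covariant_2_tensor_field C T \<longleftrightarrow>
     (\<forall>c\<in>C. \<forall>i j. smooth_on (coords c) (\<lambda>x. T c x i j)) \<and>
     (\<forall>c\<in>C. \<forall>d\<in>C. \<forall>x\<in>overlap c d. \<forall>i j.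
        T c x i j = (\<Sum>a\<in>UNIV. \<Sum>b\<in>UNIV.
          jac c d x a i * jac c d x b j * T d (transition c d x) a b))"

definition contravariant_2_tensor_field ::
    "('m, 'n::finite) chart set \<Rightarrow> (('m, 'n) chart \<Rightarrow> real^'n \<Rightarrow> 'n \<Rightarrow> 'n \<Rightarrow> real) \<Rightarrow> bool" where
  "contravariant_2_tensor_field C T \<longleftrightarrow>
     (\<forall>c\<in>C. \<forall>i j. smooth_on (coords c) (\<lambda>x. T c x i j)) \<and>
     (\<forall>c\<in>C. \<forall>d\<in>C. \<forall>x\<in>overlap c d. \<forall>a b.
        T d (transition c d x) a b = (\<Sum>i\<in>UNIV. \<Sum>j\<in>UNIV.
          jac c d x a i * jac c d x b j * T c x i j))"

definition riemannian_manifold ::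
    "'m topology \<Rightarrow> ('m, 'n::finite) chart set \<Rightarrow>
     (('m, 'n) chart \<Rightarrow> real^'n \<Rightarrow> 'n \<Rightarrow> 'n \<Rightarrow> real) \<Rightarrow> bool" where
  "riemannian_manifold X C g \<longleftrightarrow>
     smooth_manifold X C \<and> covariant_2_tensor_field C g \<and>
     (\<forall>c\<in>C. \<forall>x\<in>coords c.
        (\<forall>i j. g c x i j = g c x j i) \<and>
        (\<forall>v::real^'n. v \<noteq> 0 \<longrightarrow> (\<Sum>i\<in>UNIV. \<Sum>j\<in>UNIV. g c x i j * v $ i * v $ j) > 0))"

text \<open>Below, \<open>G\<close> stands for the components \<open>g c\<close> of the metric in one chart.\<close>

definition metric_inv ::
    "(real^'n \<Rightarrow> 'n \<Rightarrow> 'n \<Rightarrow> real) \<Rightarrow> real^'n \<Rightarrow> 'n::finite \<Rightarrow> 'n \<Rightarrow> real" where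
  "metric_inv G x i j = matrix_inv (\<chi> a b. G x a b) $ i $ j"

text \<open>\<open>christoffel G x m i j\<close> is $\Gamma^m_{ij}$. The lemmas below show that these
  coefficients are the unique torsion-free and metric ones.\<close>

definition christoffel ::
    "(real^'n \<Rightarrow> 'n \<Rightarrow> 'n \<Rightarrow> real) \<Rightarrow> real^'n \<Rightarrow> 'n::finite \<Rightarrow> 'n \<Rightarrow> 'n \<Rightarrow> real" where
  "christoffel G x m i j = (\<Sum>k\<in>UNIV. metric_inv G x m k *
     (pd i (\<lambda>y. G y j k) x + pd j (\<lambda>y. G y i k) x - pd k (\<lambda>y. G y i j) x)) / 2"

text \<open>\<open>nabla1 G u x i j\<close> is $\nabla_i u_j$, and \<open>nabla2 G T x k j l\<close> is $\nabla_k T_{jl}$.\<close>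

definition nabla1 ::
    "(real^'n \<Rightarrow> 'n \<Rightarrow> 'n \<Rightarrow> real) \<Rightarrow> (real^'n \<Rightarrow> 'n \<Rightarrow> real) \<Rightarrow>
     real^'n \<Rightarrow> 'n::finite \<Rightarrow> 'n \<Rightarrow> real" where
  "nabla1 G u x i j = pd i (\<lambda>y. u y j) x - (\<Sum>m\<in>UNIV. christoffel G x m i j * u x m)"

definition nabla2 ::
    "(real^'n \<Rightarrow> 'n \<Rightarrow> 'n \<Rightarrow> real) \<Rightarrow> (real^'n \<Rightarrow> 'n \<Rightarrow> 'n \<Rightarrow> real) \<Rightarrow>
     real^'n \<Rightarrow> 'n::finite \<Rightarrow> 'n \<Rightarrow> 'n \<Rightarrow> real" where
  "nabla2 G T x k j l = pd k (\<lambda>y. T y j l) x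
     - (\<Sum>m\<in>UNIV. christoffel G x m k j * T x m l)
     - (\<Sum>m\<in>UNIV. christoffel G x m k l * T x j m)"

text \<open>\<open>riemann G x j k l m\<close> is $R_{jkl}{}^m$, with the sign convention
  $(\nabla_j \nabla_k - \nabla_k \nabla_j) u_l = R_{jkl}{}^m u_m$. Together with
  $R_{kl} = - R_{mkl}{}^m$ this makes the Ricci tensor of a round sphere positive.\<close>

definition riemann ::
    "(real^'n \<Rightarrow> 'n \<Rightarrow> 'n \<Rightarrow> real) \<Rightarrow> real^'n \<Rightarrow> 'n::finite \<Rightarrow> 'n \<Rightarrow> 'n \<Rightarrow> 'n \<Rightarrow> real" where
  "riemann G x j k l m =
     pd k (\<lambda>y. christoffel G y m j l) x - pd j (\<lambda>y. christoffel G y m k l) x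
     + (\<Sum>p\<in>UNIV. christoffel G x p j l * christoffel G x m k p)
     - (\<Sum>p\<in>UNIV. christoffel G x p k l * christoffel G x m j p)"

definition ricci ::
    "(real^'n \<Rightarrow> 'n \<Rightarrow> 'n \<Rightarrow> real) \<Rightarrow> real^'n \<Rightarrow> 'n::finite \<Rightarrow> 'n \<Rightarrow> real" where
  "ricci G x k l = - (\<Sum>m\<in>UNIV. riemann G x m k l m)"

lemma pd_cong:
  assumes "open S" "x \<in> S" "\<And>y. y \<in> S \<Longrightarrow> f y = h y"
  shows "pd i f x = pd i h x"
proof -
  have "(f has_derivative D) (at x) \<longleftrightarrow> (h has_derivative D) (at x)" for D
    using assms has_derivative_transform_within_open[of f D x UNIV S h]
      has_derivative_transform_within_open[of h D x UNIV S f] by auto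
  then show ?thesis
    by (simp add: pd_def frechet_derivative_def)
qed

context
  fixes X :: "'m topology" and C :: "('m, 'n::finite) chart set"
    and g :: "('m, 'n) chart \<Rightarrow> real^'n \<Rightarrow> 'n \<Rightarrow> 'n \<Rightarrow> real" and c x
  assumes rm: "riemannian_manifold X C g" and c: "c \<in> C" and x: "x \<in> coords c"
begin


lemma metric_sym: "y \<in> coords c \<Longrightarrow> g c y i j = g c y j i"
  using rm c by (simp add: riemannian_manifold_def)

lemma pd_metric_sym: "pd k (\<lambda>y. g c y i j) x = pd k (\<lambda>y. g c y j i) x"
proof (rule pd_cong)
  show "open (coords c)"
    using rm c by (simp add: riemannian_manifold_def smooth_manifold_def is_chart_def)
qed (use x metric_sym in auto)

lemma metric_inv_left: "(\<Sum>m\<in>UNIV. metric_inv (g c) x k m * g c x m l) = (if k = l then 1 else 0)"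
  and metric_inv_right: "(\<Sum>m\<in>UNIV. g c x k m * metric_inv (g c) x m l) = (if k = l then 1 else 0)"
proof -
  let ?A = "\<chi> a b. g c x a b"
  have "v = 0" if "?A *v v = 0" for v
  proof (rule ccontr)
    assume "v \<noteq> 0"
    then have "0 < (\<Sum>i\<in>UNIV. \<Sum>j\<in>UNIV. g c x i j * v $ i * v $ j)"
      using rm c x by (simp add: riemannian_manifold_def)
    also have "\<dots> = (\<Sum>i\<in>UNIV. v $ i * (?A *v v) $ i)"
      by (simp add: matrix_vector_mult_def sum_distrib_left mult_ac)
    finally show False
      using that by simp
  qed
  then have "invertible ?A"
    by (simp add: invertible_left_inverse matrix_left_invertible_ker)
  then have "matrix_inv ?A ** ?A = mat 1 \<and> ?A ** matrix_inv ?A = mat 1"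
    unfolding invertible_def matrix_inv_def by (metis (mono_tags, lifting) someI_ex)
  then have "(matrix_inv ?A ** ?A) $ k $ l = mat 1 $ k $ l"
    and "(?A ** matrix_inv ?A) $ k $ l = mat 1 $ k $ l"
    by simp_all
  then show "(\<Sum>m\<in>UNIV. metric_inv (g c) x k m * g c x m l) = (if k = l then 1 else 0)"
    and "(\<Sum>m\<in>UNIV. g c x k m * metric_inv (g c) x m l) = (if k = l then 1 else 0)"
    by (simp_all add: matrix_matrix_mult_def metric_inv_def mat_def)
qed

lemma christoffel_torsion_free: "christoffel (g c) x m i j = christoffel (g c) x m j i"
  unfolding christoffel_def by (subst (3) pd_metric_sym) (simp add: algebra_simps)

lemma christoffel_lower:
  "(\<Sum>m\<in>UNIV. g c x l m * christoffel (g c) x m i j) =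
   (pd i (\<lambda>y. g c y j l) x + pd j (\<lambda>y. g c y i l) x - pd l (\<lambda>y. g c y i j) x) / 2"
proof -
  let ?F = "\<lambda>k. pd i (\<lambda>y. g c y j k) x + pd j (\<lambda>y. g c y i k) x - pd k (\<lambda>y. g c y i j) x"
  have "(\<Sum>m\<in>UNIV. g c x l m * christoffel (g c) x m i j)
      = (\<Sum>m\<in>UNIV. \<Sum>k\<in>UNIV. g c x l m * metric_inv (g c) x m k * (?F k / 2))"
    by (simp add: christoffel_def sum_distrib_left sum_divide_distrib mult_ac)
  also have "\<dots> = (\<Sum>k\<in>UNIV. (\<Sum>m\<in>UNIV. g c x l m * metric_inv (g c) x m k) * (?F k / 2))"
    by (subst sum.swap) (simp only: sum_distrib_right)
  also have "\<dots> = (\<Sum>k\<in>UNIV. if l = k then ?F k / 2 else 0)"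
    by (rule sum.cong) (simp_all add: metric_inv_right)
  also have "\<dots> = ?F l / 2"
    by simp
  finally show ?thesis .
qed

lemma christoffel_metric: "nabla2 (g c) (g c) x k j l = 0"
proof -
  have "(\<Sum>m\<in>UNIV. christoffel (g c) x m k j * g c x m l) =
        (\<Sum>m\<in>UNIV. g c x l m * christoffel (g c) x m k j)"
    using metric_sym[OF x] by (simp add: mult.commute)
  moreover have "(\<Sum>m\<in>UNIV. christoffel (g c) x m k l * g c x j m) =
        (\<Sum>m\<in>UNIV. g c x j m * christoffel (g c) x m k l)"
    by (simp add: mult.commute)
  ultimately show ?thesis
    unfolding nabla2_def christoffel_lower
    using pd_metric_sym[of k j l] pd_metric_sym[of j k l] pd_metric_sym[of l k j]
    by (simp add: field_simps)
qed

lemma christoffel_unique: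
  assumes sym: "\<And>m i j. H m i j = H m j i"
    and metric: "\<And>k j l. pd k (\<lambda>y. g c y j l) x =
      (\<Sum>m\<in>UNIV. H m k j * g c x m l) + (\<Sum>m\<in>UNIV. H m k l * g c x j m)"
  shows "H m i j = christoffel (g c) x m i j"
proof -
  have [simp]: "(\<Sum>m\<in>UNIV. H m a b * g c x d m) = (\<Sum>m\<in>UNIV. H m a b * g c x m d)" for a b d
    using metric_sym[OF x] by simp
  have lower: "pd i (\<lambda>y. g c y j k) x + pd j (\<lambda>y. g c y i k) x - pd k (\<lambda>y. g c y i j) x
      = 2 * (\<Sum>p\<in>UNIV. H p i j * g c x k p)" for k
    unfolding metric using sym by (simp add: sym[of _ k i] sym[of _ k j] sym[of _ j i])
  have "christoffel (g c) x m i j =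
      (\<Sum>k\<in>UNIV. \<Sum>p\<in>UNIV. metric_inv (g c) x m k * (H p i j * g c x k p))"
    by (simp only: christoffel_def lower sum_distrib_left sum_divide_distrib) simp
  also have "\<dots> = (\<Sum>p\<in>UNIV. (\<Sum>k\<in>UNIV. metric_inv (g c) x m k * g c x k p) * H p i j)"
    by (subst sum.swap) (simp add: sum_distrib_left sum_distrib_right mult_ac)
  also have "\<dots> = (\<Sum>p\<in>UNIV. if m = p then H p i j else 0)"
    by (rule sum.cong) (simp_all add: metric_inv_left)
  also have "\<dots> = H m i j"
    by simp
  finally show ?thesis ..
qed

end

definition z_tensor ::
    "(('m, 'n::finite) chart \<Rightarrow> real^'n \<Rightarrow> 'n \<Rightarrow> 'n \<Rightarrow> real) \<Rightarrow> ('m \<Rightarrow> real) \<Rightarrow>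
     ('m, 'n) chart \<Rightarrow> real^'n \<Rightarrow> 'n \<Rightarrow> 'n \<Rightarrow> real" where
  "z_tensor g f c x k l = ricci (g c) x k l + f (point c x) * g c x k l"

definition weakly_Z_symmetric ::
    "('m, 'n::finite) chart set \<Rightarrow> (('m, 'n) chart \<Rightarrow> real^'n \<Rightarrow> 'n \<Rightarrow> 'n \<Rightarrow> real) \<Rightarrow>
     ('m \<Rightarrow> real) \<Rightarrow> (('m, 'n) chart \<Rightarrow> real^'n \<Rightarrow> 'n \<Rightarrow> real) \<Rightarrow>
     (('m, 'n) chart \<Rightarrow> real^'n \<Rightarrow> 'n \<Rightarrow> real) \<Rightarrow>
     (('m, 'n) chart \<Rightarrow> real^'n \<Rightarrow> 'n \<Rightarrow> real) \<Rightarrow> bool" where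
  "weakly_Z_symmetric C g f A B D \<longleftrightarrow>
     scalar_field C f \<and> covector_field C A \<and> covector_field C B \<and> covector_field C D \<and>
     (\<forall>c\<in>C. \<forall>x\<in>coords c. \<forall>k j l.
        nabla2 (g c) (z_tensor g f c) x k j l =
          A c x k * z_tensor g f c x j l + B c x j * z_tensor g f c x k l
          + D c x l * z_tensor g f c x k j)"

definition nonsingular ::
    "('m, 'n::finite) chart set \<Rightarrow> (('m, 'n) chart \<Rightarrow> real^'n \<Rightarrow> 'n \<Rightarrow> 'n \<Rightarrow> real) \<Rightarrow> bool" where
  "nonsingular C T \<longleftrightarrow> (\<exists>W. contravariant_2_tensor_field C W \<and>
     (\<forall>c\<in>C. \<forall>x\<in>coords c. \<forall>h l.
        (\<Sum>k\<in>UNIV. W c x k h * T c x k l) = (if h = l then 1 else 0)))"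

definition closed_form ::
    "('m, 'n::finite) chart set \<Rightarrow> (('m, 'n) chart \<Rightarrow> real^'n \<Rightarrow> 'n \<Rightarrow> 'n \<Rightarrow> real) \<Rightarrow>
     (('m, 'n) chart \<Rightarrow> real^'n \<Rightarrow> 'n \<Rightarrow> real) \<Rightarrow> bool" where
  "closed_form C g u \<longleftrightarrow> (\<forall>c\<in>C. \<forall>x\<in>coords c. \<forall>i j.
     nabla1 (g c) (u c) x i j - nabla1 (g c) (u c) x j i = 0)"

end

theory Submission
  imports Defs
begin

text \<open>Symmetry of $Z$ in $\nabla_k Z_{jl} = A_k Z_{jl} + B_j Z_{kl} + D_l Z_{kj}$ gives
  $(B_j - D_j) Z_{kl} = (B_l - D_l) Z_{kj}$, hence $B = D$ because $Z$ is non singular, and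
  therefore $\nabla_k Z_{jl} - \nabla_j Z_{kl} = \omega_k Z_{jl} - \omega_j Z_{kl}$.
  Apply $\nabla_i$ and sum over the cyclic permutations of $i, k, j$. On the left the second
  derivatives combine to commutators, which the Ricci identity and the first Bianchi identity
  turn into the cyclic sum of $R_{ikl}{}^m Z_{jm}$, in which $\phi$ cancels. On the right
  the terms quadratic in $\omega$ cancel and the cyclic sum of
  $(\nabla_i \omega_k - \nabla_k \omega_i) Z_{jl}$ remains. Contracting that with $Z^{-1}$
  in the index $l$, and choosing the other free index different from two given ones, isolates one
  component of $d\omega$.\<close>

subsection \<open>Partial derivatives and smooth functions\<close>

text \<open>Bridge to calculus in one variable: on a coordinate line \<open>pd i f\<close> is an
  ordinary derivative, so the mean value theorem becomes available.\<close>

lemma has_real_derivative_pd: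
  assumes "f differentiable at (x + s *\<^sub>R axis i 1)"
  shows "((\<lambda>s. f (x + s *\<^sub>R axis i 1)) has_real_derivative pd i f (x + s *\<^sub>R axis i 1)) (at s)"
proof -
  let ?p = "x + s *\<^sub>R axis i 1" and ?F = "frechet_derivative f (at (x + s *\<^sub>R axis i 1))"
  have F: "(f has_derivative ?F) (at ?p)"
    using assms frechet_derivative_works by blast
  have "((\<lambda>s. x + s *\<^sub>R axis i 1) has_derivative (\<lambda>h. h *\<^sub>R axis i 1)) (at s)"
    by (auto intro!: derivative_eq_intros)
  then have "((\<lambda>s. f (x + s *\<^sub>R axis i 1)) has_derivative (\<lambda>h. ?F (h *\<^sub>R axis i 1))) (at s)"
    by (rule has_derivative_compose) (rule F)
  moreover have "?F (h *\<^sub>R axis i 1) = pd i f ?p * h" for h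
    using has_derivative_bounded_linear[OF F]
    by (simp add: pd_def linear_scale bounded_linear.linear)
  ultimately show ?thesis
    by (simp add: has_field_derivative_def)
qed

text \<open>Two uses of the mean value theorem on a square of side \<open>t\<close>: first in
  direction \<open>i\<close> for the difference of \<open>f\<close> along two opposite sides, then
  in direction \<open>j\<close> for \<open>pd i f\<close>. The bound \<open>2 * t < d\<close> keeps
  the square inside the ball.\<close>

lemma second_difference_mvt:
  fixes f :: "real^'n::finite \<Rightarrow> real"
  assumes f: "\<And>y. y \<in> ball x d \<Longrightarrow> f differentiable at y"
    and f': "\<And>y. y \<in> ball x d \<Longrightarrow> pd i f differentiable at y"
    and t: "0 < t" "2 * t < d"
  obtains y where "y \<in> ball x d"
    "f (x + t *\<^sub>R axis i 1 + t *\<^sub>R axis j 1) - f (x + t *\<^sub>R axis i 1) - f (x + t *\<^sub>R axis j 1) + f x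
      = t * t * pd j (pd i f) y"
proof -
  let ?p = "\<lambda>r s. x + r *\<^sub>R axis j 1 + s *\<^sub>R axis i 1"
  have in_ball: "?p r s \<in> ball x d" if "0 \<le> r" "r \<le> t" "0 \<le> s" "s \<le> t" for r s
  proof -
    have "dist x (?p r s) = norm (r *\<^sub>R axis j (1::real) + s *\<^sub>R axis i 1)"
      by (simp add: dist_norm norm_minus_commute algebra_simps)
    also have "\<dots> \<le> \<bar>r\<bar> + \<bar>s\<bar>"
      by (rule norm_triangle_le) simp
    also have "\<dots> < d"
      using that t by simp
    finally show ?thesis by simp
  qed
  have "\<exists>s. 0 < s \<and> s < t \<and>
      (f (?p t t) - f (?p 0 t)) - (f (?p t 0) - f (?p 0 0)) = (t - 0) * (pd i f (?p t s) - pd i f (?p 0 s))"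
  proof (rule MVT2)
    fix s assume "0 \<le> s" "s \<le> t"
    then show "((\<lambda>s. f (?p t s) - f (?p 0 s)) has_real_derivative pd i f (?p t s) - pd i f (?p 0 s)) (at s)"
      using t by (intro DERIV_diff has_real_derivative_pd f in_ball) auto
  qed (use t in simp)
  then obtain s where s: "0 < s" "s < t" and
    1: "f (?p t t) - f (?p 0 t) - (f (?p t 0) - f (?p 0 0)) = t * (pd i f (?p t s) - pd i f (?p 0 s))"
    by auto
  let ?q = "\<lambda>r. (x + s *\<^sub>R axis i 1) + r *\<^sub>R axis j 1"
  have q: "?q r = ?p r s" for r
    by (simp add: algebra_simps)
  have "\<exists>r. 0 < r \<and> r < t \<and> pd i f (?q t) - pd i f (?q 0) = (t - 0) * pd j (pd i f) (?q r)"
  proof (rule MVT2)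
    fix r assume "0 \<le> r" "r \<le> t"
    then show "((\<lambda>r. pd i f (?q r)) has_real_derivative pd j (pd i f) (?q r)) (at r)"
      using s by (intro has_real_derivative_pd f') (auto simp only: q intro!: in_ball)
  qed (use t in simp)
  then obtain r where r: "0 < r" "r < t" and
    2: "pd i f (?p t s) - pd i f (?p 0 s) = t * pd j (pd i f) (?p r s)"
    unfolding q by auto
  show thesis
  proof (rule that)
    show "?p r s \<in> ball x d"
      using r s by (intro in_ball) auto
    show "f (x + t *\<^sub>R axis i 1 + t *\<^sub>R axis j 1) - f (x + t *\<^sub>R axis i 1) - f (x + t *\<^sub>R axis j 1) + f x
      = t * t * pd j (pd i f) (?p r s)"
      using 1 unfolding 2 by (simp add: algebra_simps)
  qed
qed

text \<open>Schwarz's theorem. The second difference does not change when \<open>i\<close> and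
  \<open>j\<close> are exchanged, so both mixed derivatives attain a common value arbitrarily near
  \<open>x\<close>; their continuity does the rest.\<close>

lemma pd_commute:
  fixes f :: "real^'n::finite \<Rightarrow> real"
  assumes S: "open S" "x \<in> S" and f: "Ck_on 2 S f"
  shows "pd i (pd j f) x = pd j (pd i f) x"
proof (rule ccontr)
  let ?a = "pd i (pd j f)" and ?b = "pd j (pd i f)"
  assume "?a x \<noteq> ?b x"
  \<comment> \<open>Half the gap: a single number cannot lie within \<open>e\<close> of both values
    at \<open>x\<close>.\<close>
  define e where "e = \<bar>?a x - ?b x\<bar> / 2"
  have e: "0 < e"
    using \<open>?a x \<noteq> ?b x\<close> by (simp add: e_def)
  have diff: "\<And>y. y \<in> S \<Longrightarrow> f differentiable at y"
      "\<And>y i. y \<in> S \<Longrightarrow> pd i f differentiable at y"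
    and cont: "\<And>i j. continuous_on S (pd i (pd j f))"
    using f by (auto simp: numeral_2_eq_2)
  have near: "\<exists>d>0. \<forall>y. dist y x < d \<longrightarrow> dist (pd i (pd j f) y) (pd i (pd j f) x) < e" for i j
  proof -
    have "continuous (at x) (pd i (pd j f))"
      using cont[of i j] S by (simp add: continuous_on_eq_continuous_at)
    then show ?thesis
      using e by (simp add: continuous_at_eps_delta)
  qed
  obtain d1 where d1: "0 < d1" "\<And>y. dist y x < d1 \<Longrightarrow> dist (?a y) (?a x) < e"
    using near[of i j] by auto
  obtain d2 where d2: "0 < d2" "\<And>y. dist y x < d2 \<Longrightarrow> dist (?b y) (?b x) < e"
    using near[of j i] by auto
  obtain d3 where d3: "0 < d3" "ball x d3 \<subseteq> S"
    using S openE by blast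
  define d where "d = min d1 (min d2 d3)"
  have d: "0 < d" "d \<le> d1" "d \<le> d2" "ball x d \<subseteq> S"
    using d1 d2 d3 by (auto simp: d_def)
  define t where "t = d / 3"
  have t: "0 < t" "2 * t < d"
    using d by (auto simp: t_def)
  obtain y where y: "y \<in> ball x d"
    "f (x + t *\<^sub>R axis i 1 + t *\<^sub>R axis j 1) - f (x + t *\<^sub>R axis i 1) - f (x + t *\<^sub>R axis j 1) + f x
      = t * t * ?b y"
    by (rule second_difference_mvt[of x d f i t j]) (use diff d t in auto)
  obtain z where z: "z \<in> ball x d"
    "f (x + t *\<^sub>R axis j 1 + t *\<^sub>R axis i 1) - f (x + t *\<^sub>R axis j 1) - f (x + t *\<^sub>R axis i 1) + f x
      = t * t * ?a z"
    by (rule second_difference_mvt[of x d f j t i]) (use diff d t in auto)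
  \<comment> \<open>The far corner of the square is the same for both orders, hence so is the second
    difference.\<close>
  have "x + t *\<^sub>R axis j 1 + t *\<^sub>R axis i 1 = x + t *\<^sub>R axis i 1 + t *\<^sub>R axis j (1::real)"
    by simp
  then have "t * t * ?b y = t * t * ?a z"
    using y(2) z(2) by (simp add: algebra_simps)
  then have "?b y = ?a z"
    using t by simp
  moreover have "dist (?b y) (?b x) < e" "dist (?a z) (?a x) < e"
    using d1(2)[of z] d2(2)[of y] y(1) z(1) d by (auto simp: dist_commute)
  moreover have "dist (?a x) (?b x) = 2 * e"
    by (simp add: e_def dist_real_def)
  ultimately show False
    using dist_triangle[of "?a x" "?b x" "?a z"] by (simp add: dist_commute)
qed

section \<open>Differentiation rules for \<open>pd\<close>\<close>

lemma pd_const [simp]: "pd i (\<lambda>y. c) x = 0"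
  by (simp add: pd_def)

lemma pd_eq:
  assumes "(f has_derivative D) (at x)"
  shows "pd i f x = D (axis i 1)"
  using frechet_derivative_at[OF assms] by (simp add: pd_def)

lemma has_derivative_frechet:
  assumes "f differentiable at x"
  shows "(f has_derivative frechet_derivative f (at x)) (at x)"
  using assms frechet_derivative_works by blast

lemma pd_add:
  assumes "f differentiable at x" "h differentiable at x"
  shows "pd i (\<lambda>y. f y + h y) x = pd i f x + pd i h x"
  by (subst pd_eq[OF has_derivative_add[OF assms[THEN has_derivative_frechet]]]) (simp add: pd_def)

lemma pd_diff:
  assumes "f differentiable at x" "h differentiable at x"
  shows "pd i (\<lambda>y. f y - h y) x = pd i f x - pd i h x"
  by (subst pd_eq[OF has_derivative_diff[OF assms[THEN has_derivative_frechet]]]) (simp add: pd_def)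

lemma pd_mult:
  fixes f h :: "real^'n::finite \<Rightarrow> real"
  assumes "f differentiable at x" "h differentiable at x"
  shows "pd i (\<lambda>y. f y * h y) x = pd i f x * h x + f x * pd i h x"
  by (subst pd_eq[OF has_derivative_mult[OF assms[THEN has_derivative_frechet]]]) (simp add: pd_def)

lemma pd_sum:
  assumes "\<And>m. m \<in> I \<Longrightarrow> f m differentiable at x"
  shows "pd i (\<lambda>y. \<Sum>m\<in>I. f m y) x = (\<Sum>m\<in>I. pd i (f m) x)"
  by (subst pd_eq[OF has_derivative_sum[OF has_derivative_frechet[OF assms]]]) (simp_all add: pd_def)

lemma pd_inverse:
  fixes f :: "real^'n::finite \<Rightarrow> real"
  assumes "f differentiable at x" "f x \<noteq> 0"
  shows "pd i (\<lambda>y. inverse (f y)) x = - (inverse (f x) * pd i f x * inverse (f x))"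
  by (subst pd_eq[OF Deriv.has_derivative_inverse[OF assms(2) has_derivative_frechet[OF assms(1)]]])
    (simp add: pd_def)

section \<open>Closure properties of \<open>Ck_on\<close> and \<open>smooth_on\<close>\<close>

lemma Ck_on_cong:
  assumes "open S" "Ck_on k S f" "\<And>y. y \<in> S \<Longrightarrow> f y = h y"
  shows "Ck_on k S h"
  using assms(2,3)
proof (induction k arbitrary: f h)
  case 0
  then show ?case
    using continuous_on_cong[of S S f h] by simp
next
  case (Suc k)
  have "h differentiable at y" if y: "y \<in> S" for y
  proof -
    obtain D where "(f has_derivative D) (at y)"
      using Suc.prems(1) y by (auto simp: differentiable_def)
    then have "(h has_derivative D) (at y)"
      by (rule has_derivative_transform_within_open[OF _ assms(1) y Suc.prems(2)])
    then show ?thesis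
      by (rule differentiableI)
  qed
  moreover have "Ck_on k S (pd i h)" for i
  proof (rule Suc.IH)
    show "Ck_on k S (pd i f)"
      using Suc.prems(1) by simp
    show "pd i f y = pd i h y" if "y \<in> S" for y
      by (rule pd_cong[OF assms(1) that Suc.prems(2)])
  qed
  ultimately show ?case by simp
qed

text \<open>The recursion of \<open>Ck_on\<close> asks for continuity only at its end, so inclusion
  of the classes takes an induction; the product rule relies on it, since it contains the
  undifferentiated factors.\<close>

lemma Ck_on_Suc_imp: "Ck_on (Suc k) S f \<Longrightarrow> Ck_on k S f"
proof (induction k arbitrary: f)
  case 0
  then have "continuous (at x) f" if "x \<in> S" for x
    using that differentiable_imp_continuous_within[of f x UNIV] by simp
  then show ?case
    by (simp add: continuous_at_imp_continuous_on)
next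
  case (Suc k)
  have "\<forall>x\<in>S. f differentiable (at x)" "\<And>i. Ck_on (Suc k) S (pd i f)"
    using Suc.prems unfolding Ck_on.simps(2)[of "Suc k"] by blast+
  then show ?case
    using Suc.IH by (subst Ck_on.simps(2)) blast
qed

lemma Ck_on_const:
  fixes S :: "(real^'n::finite) set"
  shows "Ck_on k S (\<lambda>y. c)"
proof (induction k arbitrary: c)
  case (Suc k)
  have "pd i (\<lambda>y::real^'n. c) = (\<lambda>y. 0)" for i
    by (rule ext) simp
  with Suc show ?case by simp
qed simp

lemma Ck_on_pd: "Ck_on (Suc k) S f \<Longrightarrow> Ck_on k S (pd i f)"
  by simp

lemma Ck_on_SucI:
  "(\<And>x. x \<in> S \<Longrightarrow> f differentiable at x) \<Longrightarrow> (\<And>i. Ck_on k S (pd i f)) \<Longrightarrow> Ck_on (Suc k) S f"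
  by simp

text \<open>The formula for \<open>pd i\<close> is known only at points of \<open>S\<close>, so the
  induction hypothesis is carried over by \<open>Ck_on_cong\<close>. The closure proofs for products
  and inverses have the same pattern.\<close>

lemma Ck_on_add:
  assumes S: "open S" and "Ck_on k S f" "Ck_on k S h"
  shows "Ck_on k S (\<lambda>y. f y + h y)"
  using assms(2,3)
proof (induction k arbitrary: f h)
  case (Suc k)
  have diff: "f differentiable at y" "h differentiable at y" if "y \<in> S" for y
    using Suc.prems that by simp_all
  show ?case
  proof (rule Ck_on_SucI)
    show "(\<lambda>y. f y + h y) differentiable at y" if "y \<in> S" for y
      using diff[OF that] by (rule differentiable_add)
    fix i
    have "Ck_on k S (\<lambda>y. pd i f y + pd i h y)"
      by (intro Suc.IH Suc.prems[THEN Ck_on_pd])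
    then show "Ck_on k S (pd i (\<lambda>y. f y + h y))"
      by (rule Ck_on_cong[OF S]) (simp add: pd_add diff)
  qed
qed (simp add: continuous_on_add)

lemma Ck_on_mult:
  assumes S: "open S" and "Ck_on k S f" "Ck_on k S h"
  shows "Ck_on k S (\<lambda>y. f y * h y)"
  using assms(2,3)
proof (induction k arbitrary: f h)
  case (Suc k)
  have diff: "f differentiable at y" "h differentiable at y" if "y \<in> S" for y
    using Suc.prems that by simp_all
  show ?case
  proof (rule Ck_on_SucI)
    show "(\<lambda>y. f y * h y) differentiable at y" if "y \<in> S" for y
      using diff[OF that] by (rule differentiable_mult)
    fix i
    have "Ck_on k S (\<lambda>y. pd i f y * h y + f y * pd i h y)"
      by (intro Ck_on_add S Suc.IH Suc.prems[THEN Ck_on_pd] Suc.prems[THEN Ck_on_Suc_imp])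
    then show "Ck_on k S (pd i (\<lambda>y. f y * h y))"
      by (rule Ck_on_cong[OF S]) (simp add: pd_mult diff)
  qed
qed (simp add: continuous_on_mult)

lemma Ck_on_minus:
  assumes "open S" "Ck_on k S f"
  shows "Ck_on k S (\<lambda>y. - f y)"
  using Ck_on_mult[OF assms(1) Ck_on_const[of k S "-1"] assms(2)] by simp

text \<open>The derivative of the inverse is a product of \<open>pd i f\<close> and the inverse
  itself, so induction on \<open>k\<close> closes with \<open>f\<close> fixed.\<close>

lemma Ck_on_inverse:
  assumes S: "open S" and "Ck_on k S f" and nz: "\<And>y. y \<in> S \<Longrightarrow> f y \<noteq> 0"
  shows "Ck_on k S (\<lambda>y. inverse (f y))"
  using assms(2)
proof (induction k)
  case (Suc k)
  have diff: "f differentiable at y" if "y \<in> S" for y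
    using Suc.prems that by simp
  show ?case
  proof (rule Ck_on_SucI)
    show "(\<lambda>y. inverse (f y)) differentiable at y" if "y \<in> S" for y
      using diff[OF that] nz[OF that] by (rule differentiable_inverse)
    fix i
    have "Ck_on k S (\<lambda>y. - (inverse (f y) * pd i f y * inverse (f y)))"
      by (intro Ck_on_minus Ck_on_mult S Suc.IH Suc.prems[THEN Ck_on_pd] Suc.prems[THEN Ck_on_Suc_imp])
    then show "Ck_on k S (pd i (\<lambda>y. inverse (f y)))"
      by (rule Ck_on_cong[OF S]) (simp add: pd_inverse diff nz)
  qed
qed (simp add: continuous_on_inverse nz)

lemma smooth_on_const: "smooth_on S (\<lambda>y. c)"
  by (simp add: smooth_on_def Ck_on_const)

lemma smooth_on_add: "open S \<Longrightarrow> smooth_on S f \<Longrightarrow> smooth_on S h \<Longrightarrow> smooth_on S (\<lambda>y. f y + h y)"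
  by (simp add: smooth_on_def Ck_on_add)

lemma smooth_on_mult: "open S \<Longrightarrow> smooth_on S f \<Longrightarrow> smooth_on S h \<Longrightarrow> smooth_on S (\<lambda>y. f y * h y)"
  by (simp add: smooth_on_def Ck_on_mult)

lemma smooth_on_minus: "open S \<Longrightarrow> smooth_on S f \<Longrightarrow> smooth_on S (\<lambda>y. - f y)"
  by (simp add: smooth_on_def Ck_on_minus)

lemma smooth_on_diff: "open S \<Longrightarrow> smooth_on S f \<Longrightarrow> smooth_on S h \<Longrightarrow> smooth_on S (\<lambda>y. f y - h y)"
  using smooth_on_add[of S f "\<lambda>y. - h y"] by (simp add: smooth_on_minus)

lemma smooth_on_divide:
  "open S \<Longrightarrow> smooth_on S f \<Longrightarrow> smooth_on S h \<Longrightarrow> (\<And>y. y \<in> S \<Longrightarrow> h y \<noteq> 0) \<Longrightarrow>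
    smooth_on S (\<lambda>y. f y / h y)"
  by (simp add: divide_inverse smooth_on_def Ck_on_mult Ck_on_inverse)

lemma smooth_on_sum:
  "open S \<Longrightarrow> (\<And>m. m \<in> I \<Longrightarrow> smooth_on S (f m)) \<Longrightarrow> smooth_on S (\<lambda>y. \<Sum>m\<in>I. f m y)"
  by (induction I rule: infinite_finite_induct) (simp_all add: smooth_on_const smooth_on_add)

lemma smooth_on_prod:
  "open S \<Longrightarrow> (\<And>m. m \<in> I \<Longrightarrow> smooth_on S (f m)) \<Longrightarrow> smooth_on S (\<lambda>y. \<Prod>m\<in>I. f m y)"
  by (induction I rule: infinite_finite_induct) (simp_all add: smooth_on_const smooth_on_mult)

lemma smooth_on_pd: "smooth_on S f \<Longrightarrow> smooth_on S (pd i f)"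
  unfolding smooth_on_def using Ck_on.simps(2)[of _ S f] by blast

lemma smooth_on_cong:
  "open S \<Longrightarrow> smooth_on S f \<Longrightarrow> (\<And>y. y \<in> S \<Longrightarrow> f y = h y) \<Longrightarrow> smooth_on S h"
  unfolding smooth_on_def using Ck_on_cong by blast

lemma smooth_on_differentiable: "smooth_on S f \<Longrightarrow> x \<in> S \<Longrightarrow> f differentiable at x"
  unfolding smooth_on_def using Ck_on.simps(2)[of _ S f] by blast

lemmas smooth_on_intros = smooth_on_const smooth_on_add smooth_on_mult smooth_on_minus
  smooth_on_diff smooth_on_divide smooth_on_sum smooth_on_prod smooth_on_pd

section \<open>Smoothness of determinants and inverse matrices\<close>

lemma smooth_on_det:
  assumes "open S" "\<And>a b. smooth_on S (\<lambda>y. M y a b)"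
  shows "smooth_on S (\<lambda>y. det (\<chi> a b. M y a b))"
  unfolding det_def using assms by (auto intro!: smooth_on_intros)

text \<open>By Cramer's rule every entry of the inverse is a quotient of determinants in the entries
  of \<open>M\<close>.\<close>

lemma smooth_on_matrix_inv:
  fixes M :: "real^'n \<Rightarrow> 'n::finite \<Rightarrow> 'n \<Rightarrow> real"
  assumes S: "open S" and M: "\<And>a b. smooth_on S (\<lambda>y. M y a b)"
    and inv: "\<And>y. y \<in> S \<Longrightarrow> invertible (\<chi> a b. M y a b)"
  shows "smooth_on S (\<lambda>y. matrix_inv (\<chi> a b. M y a b) $ i $ j)"
proof (rule smooth_on_cong[OF S])
  \<comment> \<open>Cramer's numerator: column \<open>i\<close> is replaced by the
    \<open>j\<close>-th unit vector.\<close>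
  let ?num = "\<lambda>y. det (\<chi> a b. if b = i then axis j 1 $ a else M y a b)"
  have "smooth_on S (\<lambda>y. if b = i then axis j 1 $ a else M y a b)" for a b
    using M by (cases "b = i") (simp_all add: smooth_on_const)
  then show "smooth_on S (\<lambda>y. ?num y / det (\<chi> a b. M y a b))"
    using inv by (intro smooth_on_divide smooth_on_det S M) (simp_all add: invertible_det_nz)
  fix y assume y: "y \<in> S"
  let ?A = "\<chi> a b. M y a b"
  have "?A ** matrix_inv ?A = mat 1"
    using inv[OF y] unfolding invertible_def matrix_inv_def by (metis (mono_tags, lifting) someI_ex)
  \<comment> \<open>Column \<open>j\<close> of the inverse solves the linear system whose right side
    is the \<open>j\<close>-th unit vector.\<close>
  then have "?A *v (matrix_inv ?A *v axis j 1) = axis j 1"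
    by (simp add: matrix_vector_mul_assoc)
  then have "matrix_inv ?A *v axis j 1 =
      (\<chi> k. det (\<chi> a b. if b = k then axis j 1 $ a else ?A $ a $ b) / det ?A)"
    using inv[OF y] cramer[of ?A] by (simp add: invertible_det_nz)
  then have "matrix_inv ?A $ i $ j = det (\<chi> a b. if b = i then axis j 1 $ a else ?A $ a $ b) / det ?A"
    by (simp add: matrix_vector_mult_basis column_def vec_eq_iff)
  also have "(\<chi> a b. if b = i then axis j 1 $ a else ?A $ a $ b) =
      (\<chi> a b. if b = i then axis j 1 $ a else M y a b)"
    by (simp add: vec_eq_iff)
  finally show "?num y / det ?A = matrix_inv ?A $ i $ j" ..
qed

subsection \<open>Ricci and Bianchi identities\<close>

text \<open>\<open>nabla3 G S x i k j l\<close> is $\nabla_i S_{kjl}$.\<close>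

definition nabla3 ::
    "(real^'n \<Rightarrow> 'n \<Rightarrow> 'n \<Rightarrow> real) \<Rightarrow> (real^'n \<Rightarrow> 'n \<Rightarrow> 'n \<Rightarrow> 'n \<Rightarrow> real) \<Rightarrow>
     real^'n \<Rightarrow> 'n::finite \<Rightarrow> 'n \<Rightarrow> 'n \<Rightarrow> 'n \<Rightarrow> real" where
  "nabla3 G S x i k j l = pd i (\<lambda>y. S y k j l) x
     - (\<Sum>m\<in>UNIV. christoffel G x m i k * S x m j l)
     - (\<Sum>m\<in>UNIV. christoffel G x m i j * S x k m l)
     - (\<Sum>m\<in>UNIV. christoffel G x m i l * S x k j m)"

text \<open>Permits differentiating a tensor identity that holds on a whole open set.\<close>

lemma nabla3_cong:
  assumes "open U" "x \<in> U" "\<And>y k j l. y \<in> U \<Longrightarrow> S y k j l = S' y k j l"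
  shows "nabla3 G S x i k j l = nabla3 G S' x i k j l"
  unfolding nabla3_def
  using assms(2,3) pd_cong[OF assms(1,2), of "\<lambda>y. S y k j l" "\<lambda>y. S' y k j l"] by simp

lemma nabla3_diff_swap:
  assumes "\<And>k j l. (\<lambda>y. S y k j l) differentiable at x"
  shows "nabla3 G (\<lambda>y k j l. S y k j l - S y j k l) x i k j l
    = nabla3 G S x i k j l - nabla3 G S x i j k l"
  unfolding nabla3_def by (simp add: pd_diff assms sum_subtractf algebra_simps)

text \<open>Leibniz rule for a tensor product: the Christoffel term of index \<open>k\<close>
  completes the derivative of \<open>u\<close>, the other two complete that of
  \<open>T\<close>.\<close>

lemma nabla3_mult:
  assumes "\<And>k. (\<lambda>y. u y k) differentiable at x" "\<And>j l. (\<lambda>y. T y j l) differentiable at x"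
  shows "nabla3 G (\<lambda>y k j l. u y k * T y j l) x i k j l
    = nabla1 G u x i k * T x j l + u x k * nabla2 G T x i j l"
proof -
  have "(\<Sum>m\<in>UNIV. c m * (u x m * T x j l)) = (\<Sum>m\<in>UNIV. c m * u x m) * T x j l"
    and "(\<Sum>m\<in>UNIV. c m * (u x k * T x m l)) = u x k * (\<Sum>m\<in>UNIV. c m * T x m l)"
    and "(\<Sum>m\<in>UNIV. c m * (u x k * T x j m)) = u x k * (\<Sum>m\<in>UNIV. c m * T x j m)" for c
    by (simp_all add: sum_distrib_left sum_distrib_right mult_ac)
  then show ?thesis
    unfolding nabla3_def nabla2_def nabla1_def by (simp only: pd_mult assms) (simp add: algebra_simps)
qed

text \<open>Both sides are expanded in Christoffel symbols. In the commutator the second partial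
  derivatives cancel by \<open>pd_commute\<close>, the terms carrying \<open>nabla2\<close> in the
  derivative slot by torsion-freeness, and the first derivatives of \<open>T\<close> and the mixed
  products in pairs; what is left is curvature.\<close>

lemma ricci_identity:
  fixes G :: "real^'n \<Rightarrow> 'n::finite \<Rightarrow> 'n \<Rightarrow> real"
  assumes U: "open U" "x \<in> U" and T: "\<And>j l. Ck_on 2 U (\<lambda>y. T y j l)"
    and C: "\<And>m k j. (\<lambda>y. christoffel G y m k j) differentiable at x"
    and sym: "\<And>m k j. christoffel G x m k j = christoffel G x m j k"
  shows "nabla3 G (nabla2 G T) x i k j l - nabla3 G (nabla2 G T) x k i j l =
    (\<Sum>m\<in>UNIV. riemann G x i k j m * T x m l) + (\<Sum>m\<in>UNIV. riemann G x i k l m * T x j m)"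
proof -
  let ?C = "christoffel G x"
  have dT: "(\<lambda>y. T y j l) differentiable at x" "pd k (\<lambda>y. T y j l) differentiable at x" for j l k
    using T[of j l] U by (auto simp: numeral_2_eq_2)
  \<comment> \<open>The product rule splits the derivative of a Christoffel term into
    \<open>a\<close> and \<open>b\<close>. Primes mark the second slot of \<open>T\<close>.
    \<open>P\<close> and \<open>P'\<close> have both symbols acting on one slot, \<open>Q\<close>
    has one on each, and \<open>s\<close> belongs to the differentiation index.\<close>
  define a where "a i k j l = (\<Sum>m\<in>UNIV. pd i (\<lambda>y. christoffel G y m k j) x * T x m l)" for i k j l
  define b where "b i k j l = (\<Sum>m\<in>UNIV. ?C m k j * pd i (\<lambda>y. T y m l) x)" for i k j l
  define a' where "a' i k j l = (\<Sum>m\<in>UNIV. pd i (\<lambda>y. christoffel G y m k l) x * T x j m)" for i k j l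
  define b' where "b' i k j l = (\<Sum>m\<in>UNIV. ?C m k l * pd i (\<lambda>y. T y j m) x)" for i k j l
  define P where "P i k j l = (\<Sum>m\<in>UNIV. \<Sum>p\<in>UNIV. ?C m i j * ?C p k m * T x p l)" for i k j l
  define P' where "P' i k j l = (\<Sum>m\<in>UNIV. \<Sum>p\<in>UNIV. ?C m i l * ?C p k m * T x j p)" for i k j l
  define Q where "Q i k j l = (\<Sum>m\<in>UNIV. \<Sum>p\<in>UNIV. ?C m i j * ?C p k l * T x m p)" for i k j l
  define s where "s i k = (\<Sum>m\<in>UNIV. ?C m i k * nabla2 G T x m j l)" for i k
  have pdN: "pd i (\<lambda>y. nabla2 G T y k j l) x =
      pd i (pd k (\<lambda>y. T y j l)) x - (a i k j l + b i k j l) - (a' i k j l + b' i k j l)" for i k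
    unfolding nabla2_def a_def b_def a'_def b'_def
    by (simp add: pd_diff pd_sum pd_mult differentiable_diff differentiable_sum differentiable_mult
        dT C sum.distrib)
  have e: "(\<Sum>m\<in>UNIV. ?C m i j * nabla2 G T x k m l) = b k i j l - P i k j l - Q i k j l" for i k
    unfolding nabla2_def b_def P_def Q_def
    by (simp add: sum_distrib_left sum_subtractf sum.distrib algebra_simps)
  have f: "(\<Sum>m\<in>UNIV. ?C m i l * nabla2 G T x k j m) = b' k i j l - Q k i j l - P' i k j l" for i k
  proof -
    \<comment> \<open>Exchanging the sums identifies the mixed term of the second slot with the one
      of the first slot for swapped \<open>i\<close> and \<open>k\<close>.\<close>
    have "Q k i j l = (\<Sum>m\<in>UNIV. \<Sum>p\<in>UNIV. ?C m i l * (?C p k j * T x p m))"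
      unfolding Q_def by (subst sum.swap) (simp add: mult_ac)
    then show ?thesis
      unfolding nabla2_def b'_def P'_def
      by (simp add: sum_distrib_left sum_subtractf sum.distrib algebra_simps)
  qed
  have N: "nabla3 G (nabla2 G T) x i k j l = pd i (pd k (\<lambda>y. T y j l)) x
      - (a i k j l + b i k j l) - (a' i k j l + b' i k j l) - s i k
      - (b k i j l - P i k j l - Q i k j l) - (b' k i j l - Q k i j l - P' i k j l)" for i k
    unfolding nabla3_def pdN e f s_def by simp
  have RP: "(\<Sum>m\<in>UNIV. (\<Sum>p\<in>UNIV. ?C p i j * ?C m k p) * T x m l) = P i k j l"
    and RP': "(\<Sum>m\<in>UNIV. (\<Sum>p\<in>UNIV. ?C p i l * ?C m k p) * T x j m) = P' i k j l" for i k
    unfolding P_def P'_def sum_distrib_right by (rule sum.swap)+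
  have R: "(\<Sum>m\<in>UNIV. riemann G x i k j m * T x m l) = a k i j l - a i k j l + P i k j l - P k i j l"
    and R': "(\<Sum>m\<in>UNIV. riemann G x i k l m * T x j m) = a' k i j l - a' i k j l + P' i k j l - P' k i j l"
    unfolding riemann_def a_def a'_def
    by (simp_all only: left_diff_distrib distrib_right sum.distrib sum_subtractf RP RP')
  have "s i k = s k i"
    unfolding s_def by (simp add: sym[of _ i k])
  moreover have "pd i (pd k (\<lambda>y. T y j l)) x = pd k (pd i (\<lambda>y. T y j l)) x"
    by (rule pd_commute[OF U T])
  ultimately show ?thesis
    unfolding N R R' by simp
qed

section \<open>Algebraic symmetries of the curvature tensor\<close>

lemma riemann_antisym: "riemann G x j k l m = - riemann G x k j l m"
  by (simp add: riemann_def)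

text \<open>For symmetric Christoffel symbols the derivative terms and the quadratic terms each
  cancel in pairs. The symmetry is assumed on a neighbourhood because it is also applied under
  \<open>pd\<close>.\<close>

lemma riemann_bianchi:
  assumes "open U" "x \<in> U" and sym: "\<And>y m k j. y \<in> U \<Longrightarrow> christoffel G y m k j = christoffel G y m j k"
  shows "riemann G x j k l m + riemann G x k l j m + riemann G x l j k m = 0"
proof -
  have "pd i (\<lambda>y. christoffel G y m k j) x = pd i (\<lambda>y. christoffel G y m j k) x" for i k j
    by (rule pd_cong[OF assms(1,2)]) (rule sym)
  note this[of l k j] this[of k l j] this[of j l k]
  then show ?thesis
    unfolding riemann_def using sym[OF assms(2), of _ l j] sym[OF assms(2), of _ k j] sym[OF assms(2), of _ l k]
    by simp
qed

text \<open>The classical octahedron argument: four Bianchi identities, one for each choice of the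
  index left in the last place, are combined linearly, and the antisymmetries match their
  terms.\<close>

lemma curvature_pair_symmetric:
  fixes r :: "'a \<Rightarrow> 'a \<Rightarrow> 'a \<Rightarrow> 'a \<Rightarrow> real"
  assumes "\<And>a b c d. r a b c d = - r b a c d" "\<And>a b c d. r a b c d = - r a b d c"
    and "\<And>a b c d. r a b c d + r b c a d + r c a b d = 0"
  shows "r a b c d = r c d a b"
  using assms(3)[of a b c d] assms(3)[of b c d a] assms(3)[of c d a b] assms(3)[of d a b c]
    assms(1)[of a c b d] assms(1)[of a d b c] assms(1)[of a d c b] assms(1)[of b d c a]
    assms(2)[of a b c d] assms(2)[of a c b d] assms(2)[of a d b c] assms(2)[of b c a d]
    assms(2)[of b d a c] assms(2)[of c d a b]
  by linarith

text \<open>The fully covariant curvature tensor, whose last two indices can be exchanged.\<close>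

definition riemann_lower ::
    "(real^'n \<Rightarrow> 'n \<Rightarrow> 'n \<Rightarrow> real) \<Rightarrow> real^'n \<Rightarrow> 'n::finite \<Rightarrow> 'n \<Rightarrow> 'n \<Rightarrow> 'n \<Rightarrow> real" where
  "riemann_lower G x i j k l = (\<Sum>m\<in>UNIV. riemann G x i j k m * G x m l)"

lemma riemann_lower_antisym: "riemann_lower G x i j k l = - riemann_lower G x j i k l"
  unfolding riemann_lower_def by (simp add: riemann_antisym[of _ x i j] sum_negf)

section \<open>Curvature of a Riemannian metric in a chart\<close>

context
  fixes X :: "'m topology" and C :: "('m, 'n::finite) chart set"
    and g :: "('m, 'n) chart \<Rightarrow> real^'n \<Rightarrow> 'n \<Rightarrow> 'n \<Rightarrow> real" and c
  assumes rm: "riemannian_manifold X C g" and c: "c \<in> C"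
begin

lemma open_coords: "open (coords c)"
  using rm c by (simp add: riemannian_manifold_def smooth_manifold_def is_chart_def)

lemma smooth_on_metric: "smooth_on (coords c) (\<lambda>x. g c x i j)"
  using rm c by (simp add: riemannian_manifold_def covariant_2_tensor_field_def)

lemma smooth_on_metric_inv: "smooth_on (coords c) (\<lambda>x. metric_inv (g c) x i j)"
  unfolding metric_inv_def
proof (rule smooth_on_matrix_inv[OF open_coords smooth_on_metric])
  fix y assume y: "y \<in> coords c"
  have "matrix_inv (\<chi> a b. g c y a b) ** (\<chi> a b. g c y a b) = mat 1"
    using metric_inv_left[OF rm c y]
    by (simp add: vec_eq_iff matrix_matrix_mult_def metric_inv_def mat_def)
  then show "invertible (\<chi> a b. g c y a b)"
    unfolding invertible_left_inverse by blast
qed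

lemma smooth_on_christoffel: "smooth_on (coords c) (\<lambda>x. christoffel (g c) x m i j)"
  unfolding christoffel_def
  by (intro smooth_on_intros open_coords smooth_on_metric smooth_on_metric_inv) simp

lemma smooth_on_ricci: "smooth_on (coords c) (\<lambda>x. ricci (g c) x k l)"
  unfolding ricci_def riemann_def
  by (intro smooth_on_intros open_coords smooth_on_christoffel)

lemma riemann_bianchi_metric:
  assumes "x \<in> coords c"
  shows "riemann (g c) x j k l m + riemann (g c) x k l j m + riemann (g c) x l j k m = 0"
  by (rule riemann_bianchi[OF open_coords assms christoffel_torsion_free[OF rm c]])

lemma ricci_identity_metric:
  assumes "x \<in> coords c" "\<And>j l. smooth_on (coords c) (\<lambda>y. T y j l)"
  shows "nabla3 (g c) (nabla2 (g c) T) x i k j l - nabla3 (g c) (nabla2 (g c) T) x k i j l =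
    (\<Sum>m\<in>UNIV. riemann (g c) x i k j m * T x m l) + (\<Sum>m\<in>UNIV. riemann (g c) x i k l m * T x j m)"
proof (rule ricci_identity[OF open_coords assms(1)])
  show "(\<lambda>y. christoffel (g c) y m k j) differentiable at x" for m k j
    using smooth_on_christoffel assms(1) by (rule smooth_on_differentiable)
qed (use assms(2) christoffel_torsion_free[OF rm c assms(1)] in \<open>auto simp: smooth_on_def\<close>)

text \<open>The Ricci identity is applied to the metric itself: its commutator vanishes since the
  metric is parallel, and the two curvature terms are the two sides of the claim.\<close>

lemma riemann_lower_antisym':
  assumes "x \<in> coords c"
  shows "riemann_lower (g c) x i j k l = - riemann_lower (g c) x i j l k"
proof -
  \<comment> \<open>\<open>nabla2\<close> of the metric vanishes throughout the chart, so it may be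
    replaced by zero under a further derivative.\<close>
  have "nabla3 (g c) (nabla2 (g c) (g c)) x i j k l = nabla3 (g c) (\<lambda>y k j l. 0) x i j k l" for i j k l
    by (rule nabla3_cong[OF open_coords assms]) (rule christoffel_metric[OF rm c])
  then have "nabla3 (g c) (nabla2 (g c) (g c)) x i j k l = 0" for i j k l
    by (simp add: nabla3_def)
  then show ?thesis
    using ricci_identity_metric[where T = "g c" and i = i and k = j and j = k and l = l, OF assms smooth_on_metric]
      metric_sym[OF rm c assms assms, of k]
    by (simp add: riemann_lower_def eq_neg_iff_add_eq_0)
qed

lemma riemann_lower_bianchi:
  assumes "x \<in> coords c"
  shows "riemann_lower (g c) x i j k l + riemann_lower (g c) x j k i l + riemann_lower (g c) x k i j l = 0"
  unfolding riemann_lower_def sum.distrib[symmetric] distrib_right[symmetric]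
    riemann_bianchi_metric[OF assms] by simp

text \<open>The two forms differ in the order of the indices of \<open>metric_inv\<close>; together
  they let \<open>ricci_symmetric\<close> avoid a separate proof that the inverse metric is
  symmetric.\<close>

lemma riemann_raise:
  assumes "x \<in> coords c"
  shows "riemann (g c) x i j k m = (\<Sum>p\<in>UNIV. riemann_lower (g c) x i j k p * metric_inv (g c) x p m)"
    and "riemann (g c) x i j k m = (\<Sum>p\<in>UNIV. riemann_lower (g c) x i j k p * metric_inv (g c) x m p)"
proof -
  have "(\<Sum>p\<in>UNIV. riemann_lower (g c) x i j k p * metric_inv (g c) x p m) =
      (\<Sum>q\<in>UNIV. riemann (g c) x i j k q * (\<Sum>p\<in>UNIV. g c x q p * metric_inv (g c) x p m))"
    unfolding riemann_lower_def sum_distrib_right sum_distrib_left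
    by (subst sum.swap) (simp add: mult_ac)
  then show "riemann (g c) x i j k m = (\<Sum>p\<in>UNIV. riemann_lower (g c) x i j k p * metric_inv (g c) x p m)"
    by (simp add: metric_inv_right[OF rm c assms] if_distrib cong: if_cong)
  have "(\<Sum>p\<in>UNIV. riemann_lower (g c) x i j k p * metric_inv (g c) x m p) =
      (\<Sum>q\<in>UNIV. riemann (g c) x i j k q * (\<Sum>p\<in>UNIV. metric_inv (g c) x m p * g c x p q))"
    unfolding riemann_lower_def sum_distrib_right sum_distrib_left
    by (subst sum.swap) (simp add: mult_ac metric_sym[OF rm c assms assms])
  then show "riemann (g c) x i j k m = (\<Sum>p\<in>UNIV. riemann_lower (g c) x i j k p * metric_inv (g c) x m p)"
    by (simp add: metric_inv_left[OF rm c assms] if_distrib cong: if_cong)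
qed

text \<open>Pair symmetry and the two antisymmetries exchange the outer and the inner indices of the
  lowered tensor simultaneously; relabelling the contracted outer pair then gives the claim.\<close>

lemma ricci_symmetric:
  assumes "x \<in> coords c"
  shows "ricci (g c) x k l = ricci (g c) x l k"
proof -
  have pair: "riemann_lower (g c) x i j k l = riemann_lower (g c) x k l i j" for i j k l
    by (rule curvature_pair_symmetric)
      (rule riemann_lower_antisym riemann_lower_antisym'[OF assms] riemann_lower_bianchi[OF assms])+
  have "riemann_lower (g c) x m k l p = riemann_lower (g c) x p l k m" for m p
    using pair[of m k l p] riemann_lower_antisym[of _ x l p m k] riemann_lower_antisym'[OF assms, of p l m k]
    by simp
  then have "ricci (g c) x k l = - (\<Sum>m\<in>UNIV. \<Sum>p\<in>UNIV. riemann_lower (g c) x p l k m * metric_inv (g c) x p m)"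
    unfolding ricci_def riemann_raise(1)[OF assms] by simp
  also have "\<dots> = - (\<Sum>p\<in>UNIV. \<Sum>m\<in>UNIV. riemann_lower (g c) x p l k m * metric_inv (g c) x p m)"
    by (subst sum.swap) simp
  also have "\<dots> = ricci (g c) x l k"
    unfolding ricci_def riemann_raise(2)[OF assms] by simp
  finally show ?thesis .
qed

end

subsection \<open>Weakly Z symmetric manifolds\<close>

text \<open>Turns a lower bound on the dimension into an index that avoids given ones.\<close>

lemma ex_notin_card_less:
  fixes F :: "'n::finite set"
  assumes "card F < CARD('n)"
  shows "\<exists>i. i \<notin> F"
proof (rule ccontr)
  assume "\<nexists>i. i \<notin> F"
  then have "F = UNIV"
    by auto
  then show False
    using assms by simp
qed

text \<open>The pointwise identity behind both directions of the theorem: \<open>d\<close> is the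
  exterior derivative of \<open>A - B\<close>, so its vanishing gives the curvature condition at
  once, and the converse only has to solve a linear system for \<open>d\<close>.\<close>

lemma weakly_Z_symmetric_commutator:
  fixes X :: "'m topology" and C :: "('m, 'n::finite) chart set"
    and g :: "('m, 'n) chart \<Rightarrow> real^'n \<Rightarrow> 'n \<Rightarrow> 'n \<Rightarrow> real"
    and f :: "'m \<Rightarrow> real"
    and A B D :: "('m, 'n) chart \<Rightarrow> real^'n \<Rightarrow> 'n \<Rightarrow> real"
  assumes rm: "riemannian_manifold X C g" and card: "CARD('n) > 1"
    and wzs: "weakly_Z_symmetric C g f A B D" and ns: "nonsingular C (z_tensor g f)"
    and c: "c \<in> C" and x: "x \<in> coords c"
  defines "Z \<equiv> z_tensor g f c x"
    and "d \<equiv> \<lambda>i j. nabla1 (g c) (\<lambda>y k. A c y k - B c y k) x i j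
      - nabla1 (g c) (\<lambda>y k. A c y k - B c y k) x j i"
  shows "(\<Sum>m\<in>UNIV. ricci (g c) x i m * riemann (g c) x j k l m)
     + (\<Sum>m\<in>UNIV. ricci (g c) x j m * riemann (g c) x k i l m)
     + (\<Sum>m\<in>UNIV. ricci (g c) x k m * riemann (g c) x i j l m)
     = d j k * Z i l + d k i * Z j l + d i j * Z k l"
proof -
  let ?U = "coords c" and ?Z = "z_tensor g f c" and ?R = "riemann (g c) x"
  let ?w = "\<lambda>y k. A c y k - B c y k"
  note U = open_coords[OF rm c]
  have sym: "?Z y k l = ?Z y l k" if "y \<in> ?U" for y k l
    using ricci_symmetric[OF rm c that] metric_sym[OF rm c that that] by (simp add: z_tensor_def)
  have smoothZ: "smooth_on ?U (\<lambda>y. ?Z y k l)" for k l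
  proof -
    have "smooth_on ?U (f \<circ> point c)"
      using wzs c unfolding weakly_Z_symmetric_def scalar_field_def by blast
    then show ?thesis
      unfolding z_tensor_def comp_def
      by (intro smooth_on_add smooth_on_mult U smooth_on_ricci[OF rm c] smooth_on_metric[OF rm c])
  qed
  have smooth_w: "smooth_on ?U (\<lambda>y. ?w y k)" for k
  proof (rule smooth_on_diff[OF U])
    have "covector_field C A" "covector_field C B"
      using wzs unfolding weakly_Z_symmetric_def by blast+
    then show "smooth_on ?U (\<lambda>y. A c y k)" "smooth_on ?U (\<lambda>y. B c y k)"
      using c unfolding covector_field_def by blast+
  qed
  have smoothN: "smooth_on ?U (\<lambda>y. nabla2 (g c) ?Z y k j l)" for k j l
    unfolding nabla2_def
    by (intro smooth_on_diff smooth_on_sum smooth_on_mult smooth_on_pd U smoothZ smooth_on_christoffel[OF rm c])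
  have nabla_Z: "nabla2 (g c) ?Z y k j l = A c y k * ?Z y j l + B c y j * ?Z y k l + D c y l * ?Z y k j"
    if "y \<in> ?U" for y k j l
    using wzs[unfolded weakly_Z_symmetric_def, THEN conjunct2, THEN conjunct2, THEN conjunct2,
        THEN conjunct2, rule_format, OF c that] .
  have BD: "B c y j = D c y j" if y: "y \<in> ?U" for y j
  proof -
    have nabla_sym: "nabla2 (g c) ?Z y k j l = nabla2 (g c) ?Z y k l j" for k l
    proof -
      have "pd k (\<lambda>y. ?Z y j l) y = pd k (\<lambda>y. ?Z y l j) y"
        by (rule pd_cong[OF U y]) (rule sym)
      moreover have "(\<Sum>m\<in>UNIV. christoffel (g c) y m a b * ?Z y m e) =
          (\<Sum>m\<in>UNIV. christoffel (g c) y m a b * ?Z y e m)" for a b e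
        by (rule sum.cong) (simp_all add: sym[OF y, of e])
      ultimately show ?thesis
        unfolding nabla2_def by simp
    qed
    have eq: "(B c y j - D c y j) * ?Z y k l = (B c y l - D c y l) * ?Z y k j" for k l
      using nabla_sym[of k l] unfolding nabla_Z[OF y] sym[OF y, of l j] left_diff_distrib by linarith
    obtain W where W: "\<And>h l. (\<Sum>k\<in>UNIV. W k h * ?Z y k l) = (if h = l then 1 else 0)"
      using ns c y unfolding nonsingular_def by blast
    \<comment> \<open>Contracting \<open>eq\<close> over \<open>k\<close> with the inverse
      \<open>W\<close> turns both factors \<open>?Z\<close> into Kronecker deltas.\<close>
    have "(B c y j - D c y j) * (\<Sum>k\<in>UNIV. W k h * ?Z y k l)
        = (B c y l - D c y l) * (\<Sum>k\<in>UNIV. W k h * ?Z y k j)" for h l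
      using eq[of _ l] by (simp add: sum_distrib_left mult.left_commute)
    then have eq': "(B c y j - D c y j) * (if h = l then 1 else 0)
        = (B c y l - D c y l) * (if h = j then 1 else 0)" for h l
      unfolding W .
    have "card {j} < CARD('n)"
      using card by simp
    then obtain l where "l \<noteq> j"
      using ex_notin_card_less by blast
    \<comment> \<open>For \<open>h = l\<close> different from \<open>j\<close> the left delta is 1
      and the right one 0.\<close>
    then show ?thesis
      using eq'[of l l] by simp
  qed
  \<comment> \<open>The third terms of the defining equation cancel by symmetry of
    \<open>?Z\<close>; the first two combine to \<open>A - B\<close>. Validity on all of
    \<open>?U\<close> allows differentiation.\<close>
  have codazzi: "nabla2 (g c) ?Z y k j l - nabla2 (g c) ?Z y j k l = ?w y k * ?Z y j l - ?w y j * ?Z y k l"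
    if y: "y \<in> ?U" for y k j l
    using sym[OF y, of k j] unfolding nabla_Z[OF y] BD[OF y, symmetric] by (simp add: algebra_simps)
  define N where "N i k j l = nabla3 (g c) (nabla2 (g c) ?Z) x i k j l" for i k j l
  define V where "V i k = nabla1 (g c) ?w x i k" for i k
  define M where "M i j l = nabla2 (g c) ?Z x i j l" for i j l
  let ?P = "\<lambda>y k j l. ?w y k * ?Z y j l"
  have dP: "(\<lambda>y. ?w y k * ?Z y j l) differentiable at x" for k j l
    by (intro differentiable_mult smooth_on_differentiable[OF smoothZ x] smooth_on_differentiable[OF smooth_w x])
  have dN: "(\<lambda>y. nabla2 (g c) ?Z y k j l) differentiable at x" for k j l
    by (rule smooth_on_differentiable[OF smoothN x])
  have nabla_codazzi: "N i k j l - N i j k l = V i k * Z j l + ?w x k * M i j l - (V i j * Z k l + ?w x j * M i k l)"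
    for i j k l
  proof -
    have "N i k j l - N i j k l
        = nabla3 (g c) (\<lambda>y k j l. nabla2 (g c) ?Z y k j l - nabla2 (g c) ?Z y j k l) x i k j l"
      unfolding N_def by (rule nabla3_diff_swap[symmetric]) (rule dN)
    also have "\<dots> = nabla3 (g c) (\<lambda>y k j l. ?P y k j l - ?P y j k l) x i k j l"
      by (rule nabla3_cong[OF U x]) (rule codazzi)
    also have "\<dots> = nabla3 (g c) ?P x i k j l - nabla3 (g c) ?P x i j k l"
      by (rule nabla3_diff_swap) (rule dP)
    also have "\<dots> = V i k * Z j l + ?w x k * M i j l - (V i j * Z k l + ?w x j * M i k l)"
      unfolding V_def M_def Z_def
      by (simp only: nabla3_mult[OF smooth_on_differentiable[OF smooth_w x] smooth_on_differentiable[OF smoothZ x]])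
    finally show ?thesis .
  qed
  \<comment> \<open>Undifferentiated, \<open>codazzi\<close> trades \<open>M i j l\<close> for
    \<open>M j i l\<close>; in the cyclic sum the \<open>M\<close> terms then cancel, as do the
    resulting terms quadratic in \<open>?w\<close>.\<close>
  have swap_M: "M i j l = M j i l + (?w x i * Z j l - ?w x j * Z i l)" for i j l
    using codazzi[OF x, of i j l] unfolding M_def Z_def by simp
  have ricci_id: "N i k j l - N k i j l = (\<Sum>m\<in>UNIV. ?R i k j m * Z m l) + (\<Sum>m\<in>UNIV. ?R i k l m * Z j m)"
    for i k j l
    unfolding N_def Z_def by (rule ricci_identity_metric[OF rm c x smoothZ])
  \<comment> \<open>By the first Bianchi identity one half of the curvature terms drops out of the
    cyclic sum of \<open>ricci_id\<close>.\<close>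
  have "(\<Sum>m\<in>UNIV. ?R i k j m * Z m l) + (\<Sum>m\<in>UNIV. ?R k j i m * Z m l) + (\<Sum>m\<in>UNIV. ?R j i k m * Z m l) = 0"
    unfolding sum.distrib[symmetric] distrib_right[symmetric] riemann_bianchi_metric[OF rm c x] by simp
  \<comment> \<open>The same six terms \<open>N\<close> form commutators when paired by the first
    two indices and derivatives of \<open>codazzi\<close> when paired by the second and
    third.\<close>
  then have "(\<Sum>m\<in>UNIV. ?R i k l m * Z j m) + (\<Sum>m\<in>UNIV. ?R k j l m * Z i m) + (\<Sum>m\<in>UNIV. ?R j i l m * Z k m)
    = (N i k j l - N i j k l) + (N k j i l - N k i j l) + (N j i k l - N j k i l)"
    using ricci_id[of i k j l] ricci_id[of k j i l] ricci_id[of j i k l] by simp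
  also have "\<dots> = d i k * Z j l + d k j * Z i l + d j i * Z k l"
    unfolding nabla_codazzi swap_M[of i j l] swap_M[of k i l] swap_M[of j k l]
    by (simp add: d_def V_def algebra_simps)
  \<comment> \<open>Antisymmetry of \<open>?R\<close> and \<open>d\<close> reverses the cyclic
    orientation on both sides.\<close>
  finally have cyclic_Z: "(\<Sum>m\<in>UNIV. Z i m * ?R j k l m) + (\<Sum>m\<in>UNIV. Z j m * ?R k i l m)
      + (\<Sum>m\<in>UNIV. Z k m * ?R i j l m) = d j k * Z i l + d k i * Z j l + d i j * Z k l"
    using riemann_antisym[of "g c" x j k] riemann_antisym[of "g c" x k i] riemann_antisym[of "g c" x i j]
    by (simp add: d_def sum_negf algebra_simps)
  \<comment> \<open>The metric part of \<open>Z\<close> lowers an index of the curvature. Exchanging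
    the last two indices moves \<open>a\<close> to the third slot, where the cyclic sum vanishes by
    Bianchi.\<close>
  have split_Z: "(\<Sum>m\<in>UNIV. Z a m * ?R b e l m)
      = (\<Sum>m\<in>UNIV. ricci (g c) x a m * ?R b e l m) - f (point c x) * riemann_lower (g c) x b e a l" for a b e
  proof -
    have "riemann_lower (g c) x b e a l = - (\<Sum>m\<in>UNIV. g c x a m * ?R b e l m)"
      using riemann_lower_antisym'[OF rm c x, of b e a l] metric_sym[OF rm c x x, of a]
      by (simp add: riemann_lower_def mult.commute)
    then show ?thesis
      by (simp add: Z_def z_tensor_def sum.distrib sum_distrib_left algebra_simps)
  qed
  have "f (point c x) * (riemann_lower (g c) x j k i l + riemann_lower (g c) x k i j l
      + riemann_lower (g c) x i j k l) = 0"
    using riemann_lower_bianchi[OF rm c x, of i j k l] by simp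
  then show ?thesis
    using cyclic_Z unfolding split_Z by (simp add: algebra_simps)
qed

theorem theorem4p2:
  fixes X :: "'m topology"
    and C :: "('m, 'n::finite) chart set"
    and g :: "('m, 'n) chart \<Rightarrow> real^'n \<Rightarrow> 'n \<Rightarrow> 'n \<Rightarrow> real"
    and \<phi> :: "'m \<Rightarrow> real"
    and A B D :: "('m, 'n) chart \<Rightarrow> real^'n \<Rightarrow> 'n \<Rightarrow> real"
  assumes "riemannian_manifold X C g"
    and "CARD('n) > 3"
    and "weakly_Z_symmetric C g \<phi> A B D"
    and "nonsingular C (z_tensor g \<phi>)"
  shows "closed_form C g (\<lambda>c x k. A c x k - B c x k) \<longleftrightarrow>
    (\<forall>c\<in>C. \<forall>x\<in>coords c. \<forall>i j k l.
       (\<Sum>m\<in>UNIV. ricci (g c) x i m * riemann (g c) x j k l m)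
     + (\<Sum>m\<in>UNIV. ricci (g c) x j m * riemann (g c) x k i l m)
     + (\<Sum>m\<in>UNIV. ricci (g c) x k m * riemann (g c) x i j l m) = 0)"
    (is "?closed \<longleftrightarrow> ?cyclic")
proof
  note key = weakly_Z_symmetric_commutator[OF assms(1) _ assms(3,4)]
  show ?cyclic if ?closed
    using that assms(2) by (simp add: key closed_form_def)
  show ?closed if cyclic: ?cyclic
    unfolding closed_form_def
  proof (intro ballI allI)
    fix c x j k assume c: "c \<in> C" and x: "x \<in> coords c"
    let ?Z = "z_tensor g \<phi> c x"
    define d where "d i j = nabla1 (g c) (\<lambda>y k. A c y k - B c y k) x i j
      - nabla1 (g c) (\<lambda>y k. A c y k - B c y k) x j i" for i j
    have eq: "d j k * ?Z i l + d k i * ?Z j l + d i j * ?Z k l = 0" for i l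
      using key[OF _ c x, of i j k l] cyclic c x assms(2) by (simp add: d_def)
    have sym: "?Z i l = ?Z l i" for i l
      using ricci_symmetric[OF assms(1) c x] metric_sym[OF assms(1) c x x] by (simp add: z_tensor_def)
    have "d j k = 0"
    proof (cases "j = k")
      case False
      have "card {j, k} < CARD('n)"
        using assms(2) card_insert_le_m1[of 2 "{k}" j] by simp
      \<comment> \<open>With this \<open>i\<close>, contraction of \<open>eq\<close> with
        \<open>W l i\<close> over \<open>l\<close> yields delta 1 for the term with
        \<open>?Z i l\<close> and 0 for the other two, so only \<open>d j k\<close>
        survives.\<close>
      then obtain i where i: "i \<noteq> j" "i \<noteq> k"
        using ex_notin_card_less by blast
      obtain W where W: "\<And>h l. (\<Sum>k\<in>UNIV. W k h * ?Z k l) = (if h = l then 1 else 0)"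
        using assms(4) c x unfolding nonsingular_def by blast
      have "0 = (\<Sum>l\<in>UNIV. W l i * (d j k * ?Z i l + d k i * ?Z j l + d i j * ?Z k l))"
        unfolding eq by simp
      also have "\<dots> = d j k * (\<Sum>l\<in>UNIV. W l i * ?Z l i) + d k i * (\<Sum>l\<in>UNIV. W l i * ?Z l j)
          + d i j * (\<Sum>l\<in>UNIV. W l i * ?Z l k)"
        unfolding sym[of i] sym[of j] sym[of k]
        by (simp add: sum_distrib_left sum.distrib algebra_simps)
      also have "\<dots> = d j k"
        using i by (simp add: W)
      finally show ?thesis ..
    qed (simp add: d_def)
    then show "nabla1 (g c) (\<lambda>y k. A c y k - B c y k) x j k
        - nabla1 (g c) (\<lambda>y k. A c y k - B c y k) x k j = 0"
      by (simp add: d_def)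
  qed
qed

end
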